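(* Let $m\ge 2$ be an integer with $m\equiv 1\pmod 2$ and let $f:\mathbb{Z}_2\to\mathbb{Z}_2$, $f(x)=x^m$. 1. If $m\equiv 1\pmod 4$, let $t=\nu_2(m-1)$. Then the minimal decomposition of $\mathbb{Z}_2$ for $f$ is $$\mathbb{Z}_2=\{0,\pm1\}\ \bigsqcup\ \Big(\bigcup_{l\ge 0}\ \bigcup_{a=0}^{2^{t-1}-1}\ \bigcup_{i=1}^{2}M_{l,a,i}\Big)\ \bigsqcup\ (2\mathbb{Z}_2\setminus\{0\}),$$ where $$M_{l,a,1}=1+2^{l+2}+2^{l+3}a+2^{t+l+2}\mathbb{Z}_2,\qquad M_{l,a,2}=-1+2^{l+2}+2^{l+3}a+2^{t+l+2}\mathbb{Z}_2 .$$ 2. If $m\equiv -1\pmod 4$, let $t=\nu_2(m+1)$. Then the minimal decomposition of $\mathbb{Z}_2$ for $f$ is $$\mathbb{Z}_2=\{0,\pm1\}\ \bigsqcup\ \Big(\bigcup_{l\ge 0}\ \bigcup_{a=0}^{2^{t-1}-1}\ \bigcup_{i=1}^{2}M_{l,a,i}\Big)\ \bigsqcup\ (2\mathbb{Z}_2\setminus\{0\}),$$ where $$M_{l,a,1}=(1+2^{l+2}+2^{l+4}a+2^{t+l+3}\mathbb{Z}_2)\cup\big((1+2^{l+2}+2^{l+4}a)^{-1}+2^{t+l+2}+2^{t+l+3}\mathbb{Z}_2\big),$$ $$M_{l,a,2}=(-1+2^{l+2}+2^{l+4}a+2^{t+l+3}\mathbb{Z}_2)\cup\big((-1+2^{l+2}+2^{l+4}a)^{-1}+2^{t+l+2}+2^{t+l+3}\mathbb{Z}_2\big).$$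 In both cases $l$ ranges over the nonnegative integers, $\{0,\pm1\}$ is the set of periodic points (all of them fixed points), the sets $M_{l,a,i}$ are the minimal components, and $2\mathbb{Z}_2\setminus\{0\}$ is the attracting basin of the fixed point $0$.
   Context: $\mathbb{Z}_2$ is the ring of $2$-adic integers with its $2$-adic metric, and $\nu_2$ is the $2$-adic valuation; inverses are taken in $\mathbb{Z}_2$. For a polynomial $f$ over $\mathbb{Z}_p$, a minimal decomposition of $\mathbb{Z}_p$ for $f$ is a partition $\mathbb{Z}_p=\mathcal{P}\sqcup\mathcal{M}\sqcup\mathcal{B}$ where (1) $\mathcal{P}$ is the set of all periodic points of $f$; (2) $\mathcal{M}=\bigsqcup_i\mathcal{M}_i$ is a disjoint union of at most countably many clopen $f$-invariant sets, each a finite union of balls, such that each subsystem $f:\mathcal{M}_i\to\mathcal{M}_i$ is minimal (every forward orbit in $\mathcal{M}_i$ is dense in $\mathcal{M}_i$); the $\mathcal{M}_i$ are called minimal components; (3) each point of $\mathcal{B}$ lies in the attracting basin of a periodic orbit or of a minimal component. A point $x$ lies in the attracting basin of a closed invariant set $A$ if the distance from $f^n(x)$ to $A$ tends to $0$ as $n\to\infty$; in describing $\mathcal{B}$, the attracting set itself is not listed as part of its basin. *)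

theory Defs
  imports
    "HOL-Analysis.Analysis"
    "HOL-Number_Theory.Cong"
    "HOL-Computational_Algebra.Factorial_Ring"
    "HOL-Library.Disjoint_Sets"
begin

section \<open>The ring of 2-adic integers\<close>

text \<open>
  The inverse limit of the rings of integers modulo powers of 2.  The residue at level \<open>n\<close> is
  the representative in \<open>{0..<2^n}\<close>; the range condition follows from the compatibility condition.
\<close>

typedef two_adic = "{x :: nat \<Rightarrow> int. \<forall>n. x (Suc n) mod 2 ^ n = x n}"
  morphisms residue Abs_two_adic
  by (rule exI[of _ "\<lambda>_. 0"]) simp

setup_lifting type_definition_two_adic

lemma mod_pow2_Suc_mod: "(k :: int) mod 2 ^ Suc n mod 2 ^ n = k mod 2 ^ n"
  by (simp add: mod_mod_cancel)

lemma residue_Suc_mod: "residue x (Suc n) mod 2 ^ n = residue x n"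
  using residue[of x] by simp

instantiation two_adic :: comm_ring_1
begin

lift_definition zero_two_adic :: two_adic is "\<lambda>_. 0"
  by simp

lift_definition one_two_adic :: two_adic is "\<lambda>n. 1 mod 2 ^ n"
  by (simp only: mod_pow2_Suc_mod simp_thms)

lift_definition plus_two_adic :: "two_adic \<Rightarrow> two_adic \<Rightarrow> two_adic"
  is "\<lambda>x y n. (x n + y n) mod 2 ^ n"
  by (metis mod_add_eq mod_pow2_Suc_mod)

lift_definition minus_two_adic :: "two_adic \<Rightarrow> two_adic \<Rightarrow> two_adic"
  is "\<lambda>x y n. (x n - y n) mod 2 ^ n"
  by (metis mod_diff_eq mod_pow2_Suc_mod)

lift_definition uminus_two_adic :: "two_adic \<Rightarrow> two_adic"
  is "\<lambda>x n. (- x n) mod 2 ^ n"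
  by (metis mod_minus_eq mod_pow2_Suc_mod)

lift_definition times_two_adic :: "two_adic \<Rightarrow> two_adic \<Rightarrow> two_adic"
  is "\<lambda>x y n. (x n * y n) mod 2 ^ n"
  by (metis mod_mult_eq mod_pow2_Suc_mod)

lemma residue_mod_aux:
  assumes "\<forall>n. (x :: nat \<Rightarrow> int) (Suc n) mod 2 ^ n = x n"
  shows "x n mod 2 ^ n = x n"
  using assms by (metis mod_mod_trivial)

instance
proof
  fix a b c :: two_adic
  show "a * b * c = a * (b * c)"
    by transfer (simp add: fun_eq_iff mod_simps ac_simps)
  show "a * b = b * a"
    by transfer (simp add: fun_eq_iff ac_simps)
  show "1 * a = a"
    by (transfer, simp only: mod_mult_left_eq mult_1_left, rule ext, erule residue_mod_aux)
  show "a + b + c = a + (b + c)"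
    by transfer (simp add: fun_eq_iff mod_simps ac_simps)
  show "a + b = b + a"
    by transfer (simp add: fun_eq_iff ac_simps)
  show "0 + a = a"
    by transfer (simp add: fun_eq_iff residue_mod_aux)
  show "- a + a = 0"
    by transfer (simp add: fun_eq_iff mod_simps)
  show "a - b = a + - b"
    by transfer (simp add: fun_eq_iff mod_simps)
  show "(a + b) * c = a * c + b * c"
    by transfer (simp add: fun_eq_iff mod_simps algebra_simps)
  show "(0 :: two_adic) \<noteq> 1"
    by transfer (auto simp: fun_eq_iff intro!: exI[of _ 1])
qed

end

section \<open>The 2-adic valuation and metric\<close>

text \<open>Only meaningful for nonzero arguments, where the exponents in question are bounded.\<close>

definition nu2 :: "two_adic \<Rightarrow> nat" where
  "nu2 x = (GREATEST k. 2 ^ k dvd x)"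

lemma residue_power_self: "residue (2 ^ k) n = 2 ^ k mod 2 ^ n"
proof (induction k)
  case 0
  show ?case by (simp add: one_two_adic.rep_eq)
next
  case (Suc k)
  have "residue (1 + 1) n = (1 + 1) mod 2 ^ n"
    by (simp only: plus_two_adic.rep_eq one_two_adic.rep_eq mod_add_eq)
  then have "residue 2 n = 2 mod 2 ^ n"
    by (simp only: one_add_one)
  then show ?case
    by (simp only: power_Suc times_two_adic.rep_eq Suc mod_mult_eq)
qed

lemma residue_eq_0_if_dvd: "2 ^ k dvd x \<Longrightarrow> residue x k = 0"
  by (elim dvdE) (simp add: times_two_adic.rep_eq residue_power_self)

lemma residue_eq_0_mono: "residue x n = 0" if "residue x k = 0" "n \<le> k"
  using that(2,1)
proof (induction rule: inc_induct)
  case (step j)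
  then show ?case using residue_Suc_mod[of x j] by simp
qed simp

lemma le_nu2: "k \<le> nu2 x" if "x \<noteq> 0" "2 ^ k dvd x"
proof -
  have "\<exists>n. residue x n \<noteq> 0"
    using that(1) by transfer (auto simp: fun_eq_iff)
  then obtain n where n: "residue x n \<noteq> 0" ..
  have "j \<le> n" if "2 ^ j dvd x" for j
    using n residue_eq_0_if_dvd[OF that] residue_eq_0_mono[of x j n] by (meson nle_le)
  then show ?thesis
    unfolding nu2_def using that(2) by (intro Greatest_le_nat[where b = n]) auto
qed

lemma power_nu2_dvd: "2 ^ nu2 x dvd x"
proof (cases "x = 0")
  case False
  then show ?thesis
    unfolding nu2_def
    by (intro GreatestI_nat[where P = "\<lambda>k. 2 ^ k dvd x" and k = 0 and b = "nu2 x"]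
        le_nu2[OF False]) simp
qed simp

instantiation two_adic :: "{norm, metric_space}"
begin

definition norm_two_adic :: "two_adic \<Rightarrow> real" where
  "norm_two_adic x = (if x = 0 then 0 else 1 / 2 ^ nu2 x)"

definition dist_two_adic :: "two_adic \<Rightarrow> two_adic \<Rightarrow> real" where
  "dist_two_adic x y = norm (x - y)"

definition uniformity_two_adic :: "(two_adic \<times> two_adic) filter" where
  "uniformity_two_adic = (INF e\<in>{0 <..}. principal {(x, y). dist x y < e})"

definition open_two_adic :: "two_adic set \<Rightarrow> bool" where
  "open_two_adic U \<longleftrightarrow> (\<forall>x\<in>U. eventually (\<lambda>(x', y). x' = x \<longrightarrow> y \<in> U) uniformity)"

lemma norm_two_adic_minus: "norm (- x) = norm (x :: two_adic)"
  by (simp add: norm_two_adic_def nu2_def)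

lemma norm_two_adic_add_le: "norm (x + y) \<le> max (norm x) (norm (y :: two_adic))"
proof -
  consider "x = 0 \<or> y = 0 \<or> x + y = 0" | "x \<noteq> 0" "y \<noteq> 0" "x + y \<noteq> 0" by blast
  then show ?thesis
  proof cases
    case 2
    define k where "k = min (nu2 x) (nu2 y)"
    have "2 ^ k dvd x" "2 ^ k dvd y"
      unfolding k_def
      by (meson power_nu2_dvd dvd_trans le_imp_power_dvd min.cobounded1 min.cobounded2)+
    then have "k \<le> nu2 (x + y)"
      using 2 by (intro le_nu2) auto
    then have "1 / 2 ^ nu2 (x + y) \<le> (1 / 2 ^ k :: real)"
      by (simp add: field_simps)
    also have "\<dots> \<le> max (1 / 2 ^ nu2 x) (1 / 2 ^ nu2 y)"
      by (simp add: k_def min_def)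
    finally show ?thesis using 2 by (simp add: norm_two_adic_def)
  qed (auto simp: norm_two_adic_def le_max_iff_disj)
qed

instance
proof
  fix x y z :: two_adic
  show "(dist x y = 0) = (x = y)"
    by (simp add: dist_two_adic_def norm_two_adic_def)
  have nonneg: "norm u \<ge> 0" for u :: two_adic
    by (simp add: norm_two_adic_def)
  have "norm (x - y) = norm ((x - z) + - (y - z))" by simp
  also have "\<dots> \<le> max (norm (x - z)) (norm (y - z))"
    by (metis norm_two_adic_add_le norm_two_adic_minus)
  also have "\<dots> \<le> norm (x - z) + norm (y - z)"
    using nonneg[of "x - z"] nonneg[of "y - z"] by simp
  finally show "dist x y \<le> dist x z + dist y z"
    by (simp add: dist_two_adic_def)
qed (simp_all add: uniformity_two_adic_def open_two_adic_def)

end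

text \<open>The inverse of a unit; unspecified on non-units.\<close>

definition two_adic_inv :: "two_adic \<Rightarrow> two_adic" where
  "two_adic_inv x = (THE y. x * y = 1)"

definition two_adic_coset :: "two_adic \<Rightarrow> nat \<Rightarrow> two_adic set" where
  "two_adic_coset c k = {c + 2 ^ k * z | z. True}"

section \<open>Minimal decompositions\<close>

definition forward_orbit :: "('a \<Rightarrow> 'a) \<Rightarrow> 'a \<Rightarrow> 'a set" where
  "forward_orbit f x = range (\<lambda>n. (f ^^ n) x)"

definition periodic_points :: "('a \<Rightarrow> 'a) \<Rightarrow> 'a set" where
  "periodic_points f = {x. \<exists>n>0. (f ^^ n) x = x}"

text \<open>For invariant nonempty \<open>A\<close> this contains \<open>A\<close> itself.\<close>

definition attracting_basin :: "('a::metric_space \<Rightarrow> 'a) \<Rightarrow> 'a set \<Rightarrow> 'a set" where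
  "attracting_basin f A = {x. (\<lambda>n. infdist ((f ^^ n) x) A) \<longlonglongrightarrow> 0}"

definition minimal_component :: "('a::metric_space \<Rightarrow> 'a) \<Rightarrow> 'a set \<Rightarrow> bool" where
  "minimal_component f A \<longleftrightarrow>
     A \<noteq> {} \<and> open A \<and> closed A \<and> f ` A \<subseteq> A \<and>
     (\<exists>D. finite D \<and> (\<forall>U\<in>D. \<exists>c r. r > 0 \<and> U = ball c r) \<and> A = \<Union>D) \<and>
     (\<forall>x\<in>A. A \<subseteq> closure (forward_orbit f x))"

text \<open>
  The minimal components are given as a family, so that disjointness also says that different
  indices give different components.
\<close>

definition minimal_decomposition ::
    "('a::metric_space \<Rightarrow> 'a) \<Rightarrow> 'a set \<Rightarrow> 'i set \<Rightarrow> ('i \<Rightarrow> 'a set) \<Rightarrow> 'a set \<Rightarrow> bool" where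
  "minimal_decomposition f P I M B \<longleftrightarrow>
     P \<union> (\<Union>i\<in>I. M i) \<union> B = UNIV \<and>
     P \<inter> (\<Union>i\<in>I. M i) = {} \<and> P \<inter> B = {} \<and> (\<Union>i\<in>I. M i) \<inter> B = {} \<and>
     P = periodic_points f \<and>
     countable I \<and> disjoint_family_on M I \<and> (\<forall>i\<in>I. minimal_component f (M i)) \<and>
     (\<forall>x\<in>B. (\<exists>y\<in>P. x \<in> attracting_basin f (forward_orbit f y)) \<or>
             (\<exists>i\<in>I. x \<in> attracting_basin f (M i)))"

section \<open>The components of the power maps\<close>

definition component_index :: "nat \<Rightarrow> (nat \<times> nat \<times> nat) set" where
  "component_index t = {(l, a, i). a \<in> {0..2 ^ (t - 1) - 1} \<and> i \<in> {1, 2}}"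

definition sign_of_index :: "nat \<Rightarrow> two_adic" where
  "sign_of_index i = (if i = 1 then 1 else - 1)"

definition component_1_mod_4 :: "nat \<Rightarrow> nat \<times> nat \<times> nat \<Rightarrow> two_adic set" where
  "component_1_mod_4 t = (\<lambda>(l, a, i).
     two_adic_coset (sign_of_index i + 2 ^ (l + 2) + 2 ^ (l + 3) * of_nat a) (t + l + 2))"

definition component_3_mod_4 :: "nat \<Rightarrow> nat \<times> nat \<times> nat \<Rightarrow> two_adic set" where
  "component_3_mod_4 t = (\<lambda>(l, a, i).
     let c = sign_of_index i + 2 ^ (l + 2) + 2 ^ (l + 4) * of_nat a in
     two_adic_coset c (t + l + 3) \<union>
     two_adic_coset (two_adic_inv c + 2 ^ (t + l + 2)) (t + l + 3))"

end

theory Submission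
  imports Defs
begin

text \<open>
  Let \<open>m \<equiv> 1 (mod 4)\<close>, \<open>t = \<nu>\<^sub>2(m - 1)\<close> and \<open>\<nu>\<^sub>2(x - e) = j \<ge> 2\<close> with \<open>e = \<plusminus>1\<close>.  Lifting the
  exponent gives \<open>\<nu>\<^sub>2(x\<^bsup>m\<^esup> - x) = j + t\<close>, so the orbit of \<open>x\<close> stays in the coset of \<open>x\<close> modulo
  \<open>2\<^bsup>j + t\<^esup>\<close>.  It is dense there: as \<open>\<nu>\<^sub>2(m\<^bsup>K\<^esup> - 1) = t + k\<close> for \<open>K = 2\<^bsup>k\<^esup>\<close>,
  \<open>K\<close> further steps change an iterate by exactly \<open>2\<^bsup>j + t + k\<^esup>\<close> times a unit, which improves an
  approximation that is exact to \<open>j + t + k\<close> binary digits by one more digit.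

  If \<open>m \<equiv> -1 (mod 4)\<close> and \<open>t = \<nu>\<^sub>2(m + 1)\<close>, the same applies to \<open>m\<^sup>2\<close>, with
  \<open>\<nu>\<^sub>2(m\<^sup>2 - 1) = t + 1\<close>.  Since \<open>x \<cdot> x\<^bsup>m\<^esup> \<equiv> 1 + 2\<^bsup>j + t\<^esup> (mod 2\<^bsup>j + t + 1\<^esup>)\<close>, the map exchanges the
  coset of \<open>c\<close> and the coset of \<open>c\<^sup>-\<^sup>1 + 2\<^bsup>j + t\<^esup>\<close>.
\<close>

section \<open>Residues and divisibility by powers of 2\<close>

lemma residue_of_int: "residue (of_int a) n = a mod 2 ^ n"
proof (induction a rule: int_induct[where k = 0])
  case base
  show ?case by (simp add: zero_two_adic.rep_eq)
next
  case (step1 i)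
  then show ?case by (simp add: plus_two_adic.rep_eq one_two_adic.rep_eq mod_simps)
next
  case (step2 i)
  then show ?case by (simp add: minus_two_adic.rep_eq one_two_adic.rep_eq mod_simps)
qed

lemma residue_mod: "residue x n mod 2 ^ n = residue x n"
  using residue[of x] residue_mod_aux by blast

lemma residue_add_mod: "residue x (n + k) mod 2 ^ n = residue x n"
proof (induction k)
  case (Suc k)
  have "residue x (n + Suc k) mod 2 ^ n = residue x (Suc (n + k)) mod 2 ^ (n + k) mod 2 ^ n"
    by (simp add: mod_mod_cancel le_imp_power_dvd)
  then show ?case using Suc by (simp add: residue_Suc_mod)
qed (simp add: residue_mod)

lemma pow2_dvd_iff_residue: "2 ^ k dvd x \<longleftrightarrow> residue x k = 0"
proof
  assume x: "residue x k = 0"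
  \<comment> \<open>The lowest \<open>k\<close> binary digits of \<open>x\<close> vanish; deleting
    them leaves the digits of the quotient.\<close>
  define y where "y = (\<lambda>n. residue x (n + k) div 2 ^ k)"
  have div: "2 ^ k dvd residue x (n + k)" for n
    using residue_add_mod[of x k n] x by (simp add: add.commute mod_eq_0_iff_dvd)
  have "y (Suc n) mod 2 ^ n = y n" for n
  proof -
    have "2 ^ k * (y (Suc n) mod 2 ^ n) = (2 ^ k * y (Suc n)) mod 2 ^ (n + k)"
      by (simp only: add.commute[of n k] power_add mult_mod_right)
    also have "2 ^ k * y (Suc n) = residue x (Suc (n + k))"
      using div[of "Suc n"] by (simp add: y_def)
    also have "\<dots> mod 2 ^ (n + k) = 2 ^ k * y n"
      using div[of n] by (simp add: y_def residue_Suc_mod)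
    finally show ?thesis by simp
  qed
  then have res: "residue (Abs_two_adic y) = y"
    by (simp add: Abs_two_adic_inverse)
  have "residue x n = residue (2 ^ k * Abs_two_adic y) n" for n
  proof -
    have "residue (2 ^ k * Abs_two_adic y) n = 2 ^ k * y n mod 2 ^ n"
      by (simp add: times_two_adic.rep_eq residue_power_self res mod_simps)
    also have "2 ^ k * y n = residue x (n + k)"
      using div[of n] by (simp add: y_def)
    finally show ?thesis by (simp add: residue_add_mod)
  qed
  then have "x = 2 ^ k * Abs_two_adic y"
    by (metis residue_inject ext)
  then show "2 ^ k dvd x" by simp
qed (rule residue_eq_0_if_dvd)

lemma two_adic_approx:
  fixes x :: two_adic
  obtains a :: nat and z where "x = of_nat a + 2 ^ n * z" "a < 2 ^ n"
proof -
  define r where "r = residue x n"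
  have r: "0 \<le> r" "r < 2 ^ n"
    using residue_mod[of x n] unfolding r_def
    by (metis pos_mod_sign zero_less_numeral zero_less_power, metis pos_mod_bound zero_less_numeral zero_less_power)
  have "2 ^ n dvd x - of_int r"
    by (simp add: pow2_dvd_iff_residue minus_two_adic.rep_eq residue_of_int r_def residue_mod)
  then obtain z where "x - of_int r = 2 ^ n * z" ..
  then have "x = of_nat (nat r) + 2 ^ n * z"
    using r by (simp add: algebra_simps of_nat_nat)
  moreover have "nat r < 2 ^ n" using r by (simp add: nat_less_iff)
  ultimately show thesis using that by blast
qed

lemma pow2_dvd_of_int: "2 ^ n dvd (of_int a :: two_adic) \<longleftrightarrow> 2 ^ n dvd a"
  by (simp add: pow2_dvd_iff_residue residue_of_int mod_eq_0_iff_dvd)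

lemma two_adic_eqI: "(\<And>n. 2 ^ n dvd x - y) \<Longrightarrow> x = (y :: two_adic)"
  by (metis le_nu2 not_less_eq_eq diff_eq_eq add_0 order_refl)

text \<open>Replacing \<open>x - y\<close> by a natural number congruent to it modulo
  \<open>2 ^ n\<close> reduces the claim to cancellation in the integers.\<close>

lemma pow2_cancel: "2 ^ k * x = 2 ^ k * y \<Longrightarrow> x = (y :: two_adic)"
proof (rule ccontr)
  assume eq: "2 ^ k * x = 2 ^ k * y" and "x \<noteq> y"
  then obtain n where n: "\<not> 2 ^ n dvd x - y" using two_adic_eqI by blast
  obtain a z where a: "x - y = of_nat a + 2 ^ n * z" by (rule two_adic_approx)
  have "2 ^ k * of_nat a = - (2 ^ k * 2 ^ n * z)"
    using eq a by (simp add: algebra_simps) (metis add.commute add_diff_cancel_right' eq_neg_iff_add_eq_0 right_diff_distrib' eq_iff_diff_eq_0)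
  then have "2 ^ (k + n) dvd (of_int (2 ^ k * int a) :: two_adic)"
    by (simp add: power_add mult.assoc mult_dvd_mono)
  then have "2 ^ n dvd int a"
    unfolding pow2_dvd_of_int by (simp add: power_add)
  then have "2 ^ n dvd (of_nat a :: two_adic)"
    using pow2_dvd_of_int[of n "int a"] by simp
  then show False using n a by simp
qed

lemma pow2_dvd_cancel: "2 ^ (k + n) dvd 2 ^ k * x \<longleftrightarrow> 2 ^ n dvd (x :: two_adic)"
proof
  assume "2 ^ (k + n) dvd 2 ^ k * x"
  then obtain z where "2 ^ k * x = 2 ^ k * (2 ^ n * z)"
    by (auto simp: power_add mult.assoc elim: dvdE)
  from pow2_cancel[OF this] show "2 ^ n dvd x" by simp
qed (simp add: power_add mult_dvd_mono)

lemma pow2_dvd_le: "2 ^ k dvd x \<Longrightarrow> j \<le> k \<Longrightarrow> 2 ^ j dvd (x :: two_adic)"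
  by (meson dvd_trans le_imp_power_dvd)

section \<open>Exact powers of 2\<close>

text \<open>Exact valuation in multiplicative form: the elements \<open>1 + 2 * u\<close> are the
  units. It never holds for 0, where \<open>nu2\<close> carries no information.\<close>

definition has_val :: "nat \<Rightarrow> two_adic \<Rightarrow> bool" where
  "has_val k x \<longleftrightarrow> (\<exists>u. x = 2 ^ k * (1 + 2 * u))"

lemma even_or_odd: "2 dvd x \<or> (\<exists>u. x = 1 + 2 * (u :: two_adic))"
proof -
  obtain a z where "x = of_nat a + 2 ^ 1 * z" "a < 2 ^ 1" by (rule two_adic_approx)
  moreover from this have "a = 0 \<or> a = 1" by auto
  ultimately show ?thesis by auto
qed

lemma not_two_dvd_odd: "\<not> 2 dvd 1 + 2 * (u :: two_adic)"
  using pow2_dvd_of_int[of 1 1] by (simp add: dvd_add_left_iff)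

lemma has_val_iff: "has_val k x \<longleftrightarrow> 2 ^ k dvd x \<and> \<not> 2 ^ Suc k dvd x"
proof
  assume "has_val k x"
  then obtain u where u: "x = 2 ^ k * (1 + 2 * u)" unfolding has_val_def ..
  then show "2 ^ k dvd x \<and> \<not> 2 ^ Suc k dvd x"
    using pow2_dvd_cancel[of k 1 "1 + 2 * u"] not_two_dvd_odd[of u] by simp
next
  assume x: "2 ^ k dvd x \<and> \<not> 2 ^ Suc k dvd x"
  then obtain z where z: "x = 2 ^ k * z" by (auto elim: dvdE)
  then have "\<not> 2 dvd z" using x by (auto simp: mult.commute mult_dvd_mono)
  then show "has_val k x" using even_or_odd[of z] z unfolding has_val_def by blast
qed

lemma has_val_0_iff: "has_val 0 x \<longleftrightarrow> \<not> 2 dvd x"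
  by (simp add: has_val_iff)

lemma has_val_dvd: "has_val k x \<Longrightarrow> j \<le> k \<Longrightarrow> 2 ^ j dvd x"
  unfolding has_val_iff using pow2_dvd_le by blast

lemma has_val_nonzero: "has_val k x \<Longrightarrow> x \<noteq> 0"
  by (auto simp: has_val_iff)

lemma has_val_ex: "x \<noteq> 0 \<Longrightarrow> \<exists>k. has_val k x"
  unfolding has_val_iff using power_nu2_dvd[of x] le_nu2[of x] by (metis Suc_n_not_le_n)

lemma has_val_unique: "has_val j x \<Longrightarrow> has_val k x \<Longrightarrow> j = k"
  unfolding has_val_iff by (metis linorder_neqE_nat Suc_leI pow2_dvd_le)

lemma has_val_sign: "e \<in> {1, - 1} \<Longrightarrow> has_val 0 e"
  unfolding has_val_def by (auto intro: exI[of _ 0] exI[of _ "-1"])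

lemma has_val_mult:
  assumes "has_val j x" "has_val k y" shows "has_val (j + k) (x * y)"
proof -
  obtain u v where "x = 2 ^ j * (1 + 2 * u)" "y = 2 ^ k * (1 + 2 * v)"
    using assms unfolding has_val_def by blast
  then have "x * y = 2 ^ (j + k) * (1 + 2 * (u + v + 2 * u * v))"
    by (simp add: power_add algebra_simps)
  then show ?thesis unfolding has_val_def by blast
qed

lemma has_val_add:
  assumes "has_val k x" "2 ^ Suc k dvd y" shows "has_val k (x + y)"
proof -
  obtain u v where "x = 2 ^ k * (1 + 2 * u)" "y = 2 ^ Suc k * v"
    using assms unfolding has_val_def by (auto elim: dvdE)
  then have "x + y = 2 ^ k * (1 + 2 * (u + v))" by (simp add: algebra_simps)
  then show ?thesis unfolding has_val_def by blast
qed

lemma has_val_minus: "has_val k (- x) \<longleftrightarrow> has_val k x"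
  by (simp add: has_val_iff)

text \<open>Two odd multiples of \<open>2 ^ k\<close> add up to an even one. This carry gains the
  extra digit in the density argument.\<close>

lemma pow2_Suc_dvd_add:
  assumes "has_val k x" "has_val k y" shows "2 ^ Suc k dvd x + y"
proof -
  obtain u v where "x = 2 ^ k * (1 + 2 * u)" "y = 2 ^ k * (1 + 2 * v)"
    using assms unfolding has_val_def by blast
  then have "x + y = 2 ^ Suc k * (1 + u + v)"
    by (simp add: algebra_simps)
  then show ?thesis by simp
qed

lemma odd_power: "has_val 0 x \<Longrightarrow> has_val 0 (x ^ n)"
  using has_val_mult[of 0 x 0] by (induction n) (auto simp: has_val_def[of 0 1] intro!: exI[of _ 0])

text \<open>Valuations add and that of \<open>x\<close> is 0. Inverses of units are constructed only
  later.\<close>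

lemma odd_dvd_cancel:
  assumes "has_val 0 x" shows "2 ^ n dvd x * y \<longleftrightarrow> 2 ^ n dvd y"
proof (cases "y = 0")
  case False
  then obtain k where k: "has_val k y" using has_val_ex by blast
  then have "has_val k (x * y)" using has_val_mult[OF assms k] by simp
  then show ?thesis using k unfolding has_val_iff
    by (meson pow2_dvd_le not_less_eq_eq dvd_mult)
qed simp

lemma diff_dvd_power_diff: "x - y dvd x ^ n - y ^ n" for x y :: "'a :: comm_ring_1"
  by (simp add: power_diff_sumr2)

section \<open>Lifting the exponent and density of orbits\<close>

text \<open>The cofactor of \<open>z - 1\<close> in \<open>z ^ w - 1\<close> is a geometric sum of
  \<open>w\<close> terms congruent to 1 modulo 2, hence odd.\<close>

lemma has_val_odd_power_minus_one:
  assumes "has_val j (z - 1)" "j \<ge> 1" "odd w"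
  shows "has_val j (z ^ w - 1)"
proof -
  obtain v where w: "w = Suc (2 * v)" using assms(3) by (auto elim: oddE)
  have z: "2 dvd z - 1" using has_val_dvd[of j _ 1] assms(1,2) by simp
  have "2 dvd (\<Sum>i<n. z ^ i) - of_nat n" for n
  proof (induction n)
    case (Suc n)
    have "2 dvd z ^ n - 1" using diff_dvd_power_diff[of z 1 n] z dvd_trans by simp
    from dvd_add[OF Suc this] show ?case by (simp add: algebra_simps)
  qed simp
  from this[of w] obtain r where "(\<Sum>i<w. z ^ i) = of_nat w + 2 * r"
    by (metis dvdE diff_eq_eq add.commute)
  then have "has_val 0 (\<Sum>i<w. z ^ i)"
    unfolding has_val_def by (intro exI[of _ "of_nat v + r"]) (simp add: w algebra_simps)
  from has_val_mult[OF assms(1) this] show ?thesis by (simp add: power_diff_1_eq)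
qed

text \<open>Factor \<open>z ^ 2 - 1\<close> as \<open>(z - e) * (z + e)\<close>. Since 4 divides
  \<open>z - e\<close>, the second factor \<open>2 * e + (z - e)\<close> has valuation exactly
  1.\<close>

lemma has_val_square_minus_one:
  assumes "has_val j (z - e)" "j \<ge> 2" "e \<in> {1, - 1}"
  shows "has_val (Suc j) (z ^ 2 - 1)"
proof -
  have "has_val 1 (2 * e)"
    unfolding has_val_def using assms(3) by (auto intro: exI[of _ 0] exI[of _ "-1"])
  moreover have "2 ^ Suc 1 dvd z - e" using has_val_dvd[OF assms(1), of "Suc 1"] assms(2) by simp
  ultimately have "has_val 1 (z + e)"
    using has_val_add[of 1 "2 * e" "z - e"] by (simp add: algebra_simps)
  from has_val_mult[OF assms(1) this] have "has_val (Suc j) (z ^ 2 - e ^ 2)"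
    by (simp add: power2_eq_square algebra_simps)
  then show ?thesis using assms(3) by auto
qed

text \<open>The first squaring turns closeness to \<open>e\<close> into closeness to 1, and each
  further one adds 1 to the valuation. For \<open>e = - 1\<close> at least one squaring is
  essential, whence \<open>T \<ge> 1\<close>.\<close>

lemma has_val_power_minus_one:
  assumes "has_val j (z - e)" "j \<ge> 2" "e \<in> {1, - 1}" "T \<ge> 1" "odd w"
  shows "has_val (j + T) (z ^ (2 ^ T * w) - 1)"
proof -
  have "has_val (j + T) (z ^ 2 ^ T - 1)" using assms(4)
  proof (induction T rule: dec_induct)
    case base
    show ?case using has_val_square_minus_one[OF assms(1-3)] by simp
  next
    case (step T)
    from has_val_square_minus_one[OF step.IH] show ?case
      using assms(2) by (simp add: power_mult[symmetric] mult.commute)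
  qed
  from has_val_odd_power_minus_one[OF this _ assms(5)] show ?thesis
    using assms(2) by (simp add: power_mult)
qed

text \<open>Squaring \<open>1 + 2 ^ (T + K) * v\<close> replaces \<open>v\<close> by
  \<open>v + 2 ^ (T + K - 1) * v ^ 2\<close>, which stays odd because
  \<open>T \<ge> 2\<close>.\<close>

lemma pow2_power_expansion:
  assumes "odd w" "T \<ge> 2"
  shows "\<exists>v. odd v \<and> (1 + 2 ^ T * w) ^ 2 ^ K = 1 + 2 ^ (T + K) * (v :: nat)"
proof (induction K)
  case 0
  show ?case using assms by auto
next
  case (Suc K)
  then obtain v where v: "odd v" "(1 + 2 ^ T * w) ^ 2 ^ K = 1 + 2 ^ (T + K) * v" by blast
  obtain S where S: "T = Suc (Suc S)" using assms(2) by (metis add_Suc le_Suc_ex numeral_2_eq_2 plus_nat.add_0)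
  have "(1 + 2 ^ T * w) ^ 2 ^ Suc K = (1 + 2 ^ (T + K) * v) ^ 2"
    by (simp only: power_Suc2 power_mult v(2))
  also have "\<dots> = 1 + 2 ^ (T + Suc K) * (v + 2 * (2 ^ (S + K) * v ^ 2))"
    by (simp add: S power2_eq_square power_add algebra_simps)
  finally show ?case using v(1) by (intro exI[of _ "v + 2 * (2 ^ (S + K) * v ^ 2)"]) auto
qed

lemma power_orbit_dense:
  assumes x: "has_val j (x - e)" "j \<ge> 2" "e \<in> {1, - 1}"
    and M: "M = 1 + 2 ^ T * w" "odd w" "T \<ge> 2"
    and y: "2 ^ (j + T) dvd x - y"
  shows "\<exists>n. 2 ^ N dvd x ^ M ^ n - y"
proof -
  have odd_x: "has_val 0 x"
  proof -
    have "2 ^ Suc 0 dvd x - e"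
      using has_val_dvd[OF x(1), of "Suc 0"] x(2) by simp
    then show ?thesis using has_val_add[OF has_val_sign[OF x(3)], of "x - e"] by simp
  qed
  \<comment> \<open>The first conjunct keeps the iterate at valuation exactly \<open>j\<close> from
    \<open>e\<close>, so that lifting the exponent applies to it again.\<close>
  have "\<exists>n. 2 ^ (j + T) dvd x ^ M ^ n - x \<and> 2 ^ (j + T + K) dvd x ^ M ^ n - y" for K
  proof (induction K)
    case 0
    show ?case using y by (intro exI[of _ 0]) simp
  next
    case (Suc K)
    then obtain n where n: "2 ^ (j + T) dvd x ^ M ^ n - x" "2 ^ (j + T + K) dvd x ^ M ^ n - y"
      by blast
    define z where "z = x ^ M ^ n"
    show ?case
    proof (cases "2 ^ (j + T + Suc K) dvd z - y")
      case True
      then show ?thesis using n z_def by blast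
    next
      case False
      \<comment> \<open>The next digit is wrong. The error \<open>z - y\<close> and the displacement
        of \<open>z\<close> by \<open>2 ^ K\<close> further steps both have valuation exactly
        \<open>j + T + K\<close>, so their sum gains a digit.\<close>
      then have zy: "has_val (j + T + K) (z - y)" using n(2) by (simp add: has_val_iff z_def)
      have "2 ^ Suc j dvd z - x"
        using pow2_dvd_le[OF n(1), of "Suc j"] M(3) unfolding z_def by simp
      then have ze: "has_val j (z - e)"
        using has_val_add[OF x(1), of "z - x"] by simp
      obtain v where v: "odd v" "M ^ 2 ^ K = 1 + 2 ^ (T + K) * v"
        using pow2_power_expansion[OF M(2,3)] M(1) by blast
      have "has_val (j + (T + K)) (z ^ (2 ^ (T + K) * v) - 1)"
        using M(3) by (intro has_val_power_minus_one[OF ze x(2,3) _ v(1)]) simp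
      from has_val_mult[OF odd_power[OF odd_x, of "M ^ n"] this]
      have zz: "has_val (j + T + K) (z ^ M ^ 2 ^ K - z)"
        by (simp add: v(2) z_def[symmetric] algebra_simps)
      have eq: "x ^ M ^ (n + 2 ^ K) = z ^ M ^ 2 ^ K"
        by (simp add: z_def power_add power_mult)
      have "2 ^ (j + T + Suc K) dvd x ^ M ^ (n + 2 ^ K) - y"
        using pow2_Suc_dvd_add[OF zz zy] by (simp add: eq)
      moreover have "2 ^ (j + T) dvd x ^ M ^ (n + 2 ^ K) - x"
      proof -
        have "2 ^ (j + T) dvd z ^ M ^ 2 ^ K - z"
          using has_val_dvd[OF zz] by simp
        from dvd_add[OF this n(1)] show ?thesis by (simp add: eq z_def)
      qed
      ultimately show ?thesis by blast
    qed
  qed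
  then show ?thesis by (meson pow2_dvd_le le_add2)
qed


section \<open>Cosets as clopen balls\<close>

lemma mem_two_adic_coset: "y \<in> two_adic_coset c k \<longleftrightarrow> 2 ^ k dvd y - c"
  unfolding two_adic_coset_def dvd_def by (auto simp: algebra_simps)

text \<open>Nonzero distances are powers of 1/2, so being strictly below \<open>2 / 2 ^ k\<close>
  means being at most \<open>1 / 2 ^ k\<close>. This makes cosets open balls.\<close>

lemma dist_less_iff_dvd: "dist x y < 2 / 2 ^ k \<longleftrightarrow> 2 ^ k dvd x - (y :: two_adic)"
proof (cases "x = y")
  case False
  then have "dist x y < 2 / 2 ^ k \<longleftrightarrow> (2 :: real) ^ k < 2 ^ Suc (nu2 (x - y))"
    by (simp add: dist_two_adic_def norm_two_adic_def field_simps)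
  also have "\<dots> \<longleftrightarrow> k \<le> nu2 (x - y)"
    by (subst power_strict_increasing_iff) auto
  also have "\<dots> \<longleftrightarrow> 2 ^ k dvd x - y"
    using False le_nu2[of "x - y"] pow2_dvd_le[OF power_nu2_dvd[of "x - y"]] by auto
  finally show ?thesis .
qed simp

lemma two_adic_coset_eq_ball: "two_adic_coset c k = ball c (2 / 2 ^ k)"
  by (auto simp: mem_two_adic_coset dist_less_iff_dvd[symmetric] dist_commute)

lemma closed_two_adic_coset: "closed (two_adic_coset c k)"
proof -
  have "- two_adic_coset c k = (\<Union>y \<in> - two_adic_coset c k. two_adic_coset y k)"
  proof (intro equalityI subsetI)
    fix z assume "z \<in> (\<Union>y \<in> - two_adic_coset c k. two_adic_coset y k)"
    then obtain y where y: "\<not> 2 ^ k dvd y - c" "2 ^ k dvd z - y"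
      by (auto simp: mem_two_adic_coset)
    have "y - c = (z - c) - (z - y)" by simp
    with y have "\<not> 2 ^ k dvd z - c" by (metis dvd_diff)
    then show "z \<in> - two_adic_coset c k" by (simp add: mem_two_adic_coset)
  next
    fix y assume "y \<in> - two_adic_coset c k"
    moreover have "y \<in> two_adic_coset y k" by (simp add: mem_two_adic_coset)
    ultimately show "y \<in> (\<Union>y \<in> - two_adic_coset c k. two_adic_coset y k)" by blast
  qed
  also have "open \<dots>" by (auto simp: two_adic_coset_eq_ball)
  finally show ?thesis by (simp add: closed_def)
qed

lemma closure_two_adicI:
  assumes "\<And>N. \<exists>x\<in>S. 2 ^ N dvd x - y"
  shows "y \<in> closure (S :: two_adic set)"
  unfolding closure_approachable
proof (intro allI impI)
  fix e :: real assume "e > 0"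
  then obtain N where N: "(1 / 2) ^ N < e / 2"
    using real_arch_pow_inv[of "e / 2" "1 / 2"] by auto
  obtain x where "x \<in> S" "2 ^ N dvd x - y" using assms by blast
  then have "dist x y < 2 / 2 ^ N"
    by (simp add: dist_less_iff_dvd)
  also have "\<dots> < e" using N by (simp add: power_one_over field_simps)
  finally show "\<exists>x\<in>S. dist x y < e" using \<open>x \<in> S\<close> by blast
qed

lemma funpow_power: "((\<lambda>x. x ^ m) ^^ n) x = x ^ m ^ n" for x :: "'a :: monoid_mult"
  by (induction n) (simp_all add: power_mult[symmetric] mult.commute)

text \<open>The set \<open>C\<close> has one element for exponents congruent to 1 modulo 4 and two
  centres for those congruent to -1. Density is stated through the closed form
  \<open>x ^ m ^ n\<close> of the iterates.\<close>

lemma minimal_component_cosetsI: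
  assumes A: "A = (\<Union>c\<in>C. two_adic_coset c k)" and C: "finite C" "C \<noteq> {}"
    and invariant: "\<And>x. x \<in> A \<Longrightarrow> x ^ m \<in> A"
    and dense: "\<And>x y N. x \<in> A \<Longrightarrow> y \<in> A \<Longrightarrow> \<exists>n. 2 ^ N dvd x ^ m ^ n - y"
  shows "minimal_component (\<lambda>x. x ^ m) A"
  unfolding minimal_component_def
proof (intro conjI ballI subsetI)
  have "c \<in> two_adic_coset c k" for c by (simp add: mem_two_adic_coset)
  then show "A \<noteq> {}" using A C by blast
  show "open A" unfolding A by (auto simp: two_adic_coset_eq_ball)
  show "closed A" unfolding A using C closed_two_adic_coset by blast
  show "y \<in> A" if "y \<in> (\<lambda>x. x ^ m) ` A" for y using that invariant by blast
  have "\<forall>U\<in>(\<lambda>c. two_adic_coset c k) ` C. \<exists>c r. r > 0 \<and> U = ball c r"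
  proof
    fix U assume "U \<in> (\<lambda>c. two_adic_coset c k) ` C"
    then obtain c where "U = ball c (2 / 2 ^ k)" by (auto simp: two_adic_coset_eq_ball)
    moreover have "2 / 2 ^ k > (0 :: real)" by simp
    ultimately show "\<exists>c r. r > 0 \<and> U = ball c r" by blast
  qed
  then show "\<exists>D. finite D \<and> (\<forall>U\<in>D. \<exists>c r. r > 0 \<and> U = ball c r) \<and> A = \<Union> D"
    using C(1) A by blast
  show "y \<in> closure (forward_orbit (\<lambda>x. x ^ m) x)" if "x \<in> A" "y \<in> A" for x y
    using dense[OF that] by (intro closure_two_adicI) (auto simp: forward_orbit_def funpow_power)
qed

section \<open>Units near the fixed points\<close>

lemma not_4_dvd_2: "\<not> 2 ^ 2 dvd (2 :: two_adic)"
  using pow2_dvd_of_int[of 2 2] by simp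

lemma has_val_sign_imp_odd:
  assumes "has_val (l + 2) (x - e)" "e \<in> {1, - 1}"
  shows "has_val 0 x"
  using has_val_add[OF has_val_sign[OF assms(2)], of "x - e"] has_val_dvd[OF assms(1), of "Suc 0"]
  by simp

lemma sign_of_index_in: "sign_of_index i \<in> {1, - 1}"
  by (simp add: sign_of_index_def)

text \<open>The two signs differ by 2 and are therefore distinct modulo 4.\<close>

lemma sign_eq_if_dvd:
  assumes "2 ^ 2 dvd x - d" "2 ^ 2 dvd x - e" "d \<in> {1, - 1}" "e \<in> {1, - 1}"
  shows "d = (e :: two_adic)"
proof -
  have "2 ^ 2 dvd e - d" using dvd_diff[OF assms(1,2)] by simp
  then show ?thesis using assms(3,4) not_4_dvd_2 dvd_minus_iff[of "2^2" "2 :: two_adic"] by auto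
qed

lemma sign_of_index_unique:
  assumes "has_val (l + 2) (x - sign_of_index i)" "has_val (l' + 2) (x - sign_of_index i')"
    "i \<in> {1, 2}" "i' \<in> {1, 2}"
  shows "i = i' \<and> l = l'"
proof -
  have eq: "sign_of_index i = sign_of_index i'"
    using has_val_dvd[OF assms(1), of 2] has_val_dvd[OF assms(2), of 2]
    by (intro sign_eq_if_dvd[of x] sign_of_index_in) auto
  moreover have "(1 :: two_adic) \<noteq> - 1"
    using not_4_dvd_2 by (metis add.right_inverse dvd_0_right one_add_one)
  ultimately have "i = i'" using assms(3,4) by (auto simp: sign_of_index_def split: if_splits)
  then show ?thesis using has_val_unique[OF assms(1)] assms(2) eq by auto
qed

text \<open>An odd element is 1 or 3 modulo 4, hence congruent to a sign. As it is not itself a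
  sign, the difference has a finite valuation, at least 2; this explains the offset in
  \<open>l + 2\<close>.\<close>

lemma odd_has_val_sign:
  assumes "has_val 0 x" "x \<notin> {1, - 1}"
  obtains l i where "i \<in> {1, 2}" "has_val (l + 2) (x - sign_of_index i)"
proof -
  obtain a z where a: "x = of_nat a + 2 ^ 2 * z" "a < 2 ^ 2" by (rule two_adic_approx)
  have "\<not> 2 dvd x" using assms(1) by (simp add: has_val_iff)
  moreover have "2 dvd (2 ^ 2 * z)" using pow2_dvd_le[of 2 "2 ^ 2 * z" 1] by simp
  ultimately have "a = 1 \<or> a = 3" using a dvd_add[of 2 2 "2 ^ 2 * z"]
    by (auto simp: less_Suc_eq numeral_eq_Suc)
  then have "\<exists>i\<in>{1, 2}. 2 ^ 2 dvd x - sign_of_index i"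
  proof
    assume "a = 3"
    then have "x - sign_of_index 2 = 2 ^ 2 * (1 + z)"
      using a by (simp add: sign_of_index_def algebra_simps)
    then show ?thesis by (metis dvd_triv_left insertI1 insertI2)
  qed (use a in \<open>auto simp: sign_of_index_def\<close>)
  then obtain i where i: "i \<in> {1, 2}" "2 ^ 2 dvd x - sign_of_index i" ..
  have "x - sign_of_index i \<noteq> 0" using assms(2) by (auto simp: sign_of_index_def)
  then obtain k where k: "has_val k (x - sign_of_index i)" using has_val_ex by blast
  then have "2 \<le> k" using i(2) unfolding has_val_iff by (meson not_less_eq_eq pow2_dvd_le)
  then obtain l where "k = l + 2" by (metis add.commute le_Suc_ex)
  then show thesis using that i(1) k by blast
qed

section \<open>Periodic points, the basin of 0, and assembly of the decomposition\<close>

lemma periodic_points_power: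
  assumes "m \<ge> 2" "odd m"
  shows "periodic_points (\<lambda>x :: two_adic. x ^ m) = {0, 1, - 1}"
proof (intro equalityI subsetI)
  fix x :: two_adic assume "x \<in> periodic_points (\<lambda>x. x ^ m)"
  then obtain n where n: "n > 0" "x ^ m ^ n = x"
    unfolding periodic_points_def funpow_power by blast
  define M where "M = m ^ n"
  have "m \<le> M" unfolding M_def using n(1) assms(1) by (simp add: self_le_power)
  then have "M \<ge> 2" "odd M" using assms by (auto simp: M_def)
  show "x \<in> {0, 1, - 1}"
  proof (rule ccontr)
    assume x: "x \<notin> {0, 1, - 1}"
    \<comment> \<open>For a unit, \<open>x ^ (M - 1) - 1\<close> has a finite valuation and so is
      nonzero. For a nonunit of valuation \<open>k > 0\<close>, \<open>x ^ M\<close> is divisible by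
      \<open>2 ^ (k * M)\<close>, and \<open>k * M > k\<close>.\<close>
    show False
    proof (cases "has_val 0 x")
      case True
      then obtain l i where l: "has_val (l + 2) (x - sign_of_index i)"
        using odd_has_val_sign[of x] x by blast
      obtain w where w: "M - 1 = 2 ^ multiplicity 2 (M - 1) * w" "odd w"
        using multiplicity_decompose'[of "M - 1" 2] \<open>M \<ge> 2\<close> by auto
      \<comment> \<open>\<open>M\<close> is odd, which supplies the squaring that lifting the
        exponent requires.\<close>
      have "multiplicity 2 (M - 1) \<ge> 1"
        using \<open>odd M\<close> \<open>M \<ge> 2\<close> by (intro multiplicity_geI) auto
      from has_val_power_minus_one[OF l _ sign_of_index_in this w(2)]
      have "has_val (l + 2 + multiplicity 2 (M - 1)) (x ^ (M - 1) - 1)" by (simp only: w(1)[symmetric])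
      from has_val_nonzero[OF has_val_mult[OF True this]]
      have "x ^ Suc (M - 1) \<noteq> x" by (simp add: algebra_simps)
      moreover have "Suc (M - 1) = M" using \<open>M \<ge> 2\<close> by simp
      ultimately show False using n(2) by (metis M_def)
    next
      case False
      obtain k where k: "has_val k x" using x has_val_ex by blast
      then have "k \<noteq> 0" using False by metis
      have "2 ^ (k * M) dvd x ^ M"
        using k unfolding has_val_iff by (simp add: power_mult dvd_power_same)
      moreover have "Suc k \<le> k * M"
        using mult_le_mono2[OF \<open>M \<ge> 2\<close>, of k] \<open>k \<noteq> 0\<close> by linarith
      ultimately have "2 ^ Suc k dvd x"
        using n(2) pow2_dvd_le[of "k * M" x "Suc k"] by (simp add: M_def)
      then show False using k by (simp add: has_val_iff)
    qed
  qed
next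
  fix x :: two_adic assume "x \<in> {0, 1, - 1}"
  then show "x \<in> periodic_points (\<lambda>x. x ^ m)"
    using assms unfolding periodic_points_def by (auto simp: power_0_left intro!: exI[of _ 1])
qed

text \<open>Iterates of an odd point are odd and stay at distance 1 from 0. For even
  \<open>x\<close>, \<open>2 ^ m ^ n\<close> divides \<open>x ^ m ^ n\<close>, and
  \<open>m ^ n\<close> is at least \<open>n\<close>. The point 0 belongs to this basin.\<close>

lemma attracting_basin_zero:
  assumes "m \<ge> 2"
  shows "attracting_basin (\<lambda>x :: two_adic. x ^ m) {0} = range ((*) 2)"
proof (intro equalityI subsetI)
  fix x :: two_adic assume "x \<in> attracting_basin (\<lambda>x. x ^ m) {0}"
  then have "(\<lambda>n. dist (x ^ m ^ n) 0) \<longlonglongrightarrow> 0"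
    by (simp add: attracting_basin_def funpow_power)
  then have "eventually (\<lambda>n. dist (x ^ m ^ n) 0 < 1) sequentially"
    by (rule order_tendstoD) simp
  then obtain n where "dist (x ^ m ^ n) 0 < 2 / 2 ^ 1"
    by (auto simp: eventually_sequentially)
  then have "\<not> has_val 0 (x ^ m ^ n)"
    unfolding dist_less_iff_dvd by (simp add: has_val_iff)
  then have "2 dvd x" using odd_power[of x] has_val_0_iff by blast
  then show "x \<in> range ((*) 2)" by (auto elim: dvdE)
next
  fix x :: two_adic assume "x \<in> range ((*) 2)"
  then have x: "2 dvd x" by auto
  have "dist (x ^ m ^ n) 0 \<le> 2 * (1 / 2) ^ n" for n
  proof -
    have "n \<le> m ^ n" using less_exp[of n] power_mono[OF assms, of n] by linarith
    then have "2 ^ n dvd x ^ m ^ n"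
      using x by (meson dvd_power_same pow2_dvd_le)
    then show ?thesis using dist_less_iff_dvd[of "x ^ m ^ n" 0 n] by (simp add: power_one_over)
  qed
  moreover have "(\<lambda>n. 2 * (1 / 2) ^ n :: real) \<longlonglongrightarrow> 0"
    by (intro tendsto_mult_right_zero LIMSEQ_power_zero) simp
  ultimately have "(\<lambda>n. dist (x ^ m ^ n) 0) \<longlonglongrightarrow> 0"
    using tendsto_sandwich[OF _ _ tendsto_const[of 0],
        of "\<lambda>n. dist (x ^ m ^ n) 0" sequentially "\<lambda>n. 2 * (1 / 2) ^ n"]
    by simp
  then show "x \<in> attracting_basin (\<lambda>x. x ^ m) {0}"
    by (simp add: attracting_basin_def funpow_power)
qed

text \<open>Common frame of both cases. By \<open>val\<close> a point determines \<open>i\<close>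
  (its class modulo 4) and \<open>l\<close>, so disjointness is left to \<open>sep\<close> for the
  index \<open>a\<close>; with \<open>cover\<close>, the components fill the units other than the
  two signs.\<close>

lemma minimal_decomposition_powerI:
  fixes M :: "nat \<times> nat \<times> nat \<Rightarrow> two_adic set"
  assumes m: "m \<ge> 2" "odd m"
    and val: "\<And>l a i y. y \<in> M (l, a, i) \<Longrightarrow> has_val (l + 2) (y - sign_of_index i)"
    and sep: "\<And>l a a' i y. \<lbrakk>(l, a, i) \<in> component_index t; (l, a', i) \<in> component_index t;
      y \<in> M (l, a, i); y \<in> M (l, a', i)\<rbrakk> \<Longrightarrow> a = a'"
    and cover: "\<And>l i y. \<lbrakk>i \<in> {1, 2}; has_val (l + 2) (y - sign_of_index i)\<rbrakk> \<Longrightarrow>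
      \<exists>a. (l, a, i) \<in> component_index t \<and> y \<in> M (l, a, i)"
    and minimal: "\<And>l a i. minimal_component (\<lambda>x. x ^ m) (M (l, a, i))"
  shows "minimal_decomposition (\<lambda>x. x ^ m) {0, 1, - 1} (component_index t) M (range ((*) 2) - {0})"
proof -
  have even: "x \<in> range ((*) 2) \<longleftrightarrow> \<not> has_val 0 x" for x :: two_adic
    by (auto simp: has_val_0_iff elim: dvdE)
  have units: "(\<Union>i\<in>component_index t. M i) = {x. has_val 0 x} - {1, - 1}"
  proof (intro equalityI subsetI)
    fix x assume "x \<in> (\<Union>i\<in>component_index t. M i)"
    then obtain l a i where "x \<in> M (l, a, i)" by auto
    note v = val[OF this]
    have "x \<notin> {1, - 1}"
    proof
      assume x: "x \<in> {1, - 1}"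
      then have "x = sign_of_index i"
        using has_val_dvd[OF v, of 2] by (intro sign_eq_if_dvd[of x] sign_of_index_in) auto
      then show False using has_val_nonzero[OF v] by simp
    qed
    then show "x \<in> {x. has_val 0 x} - {1, - 1}"
      using has_val_sign_imp_odd[OF v sign_of_index_in] by simp
  next
    fix x assume "x \<in> {x. has_val 0 x} - {1, - 1}"
    then obtain l i where "i \<in> {1, 2}" "has_val (l + 2) (x - sign_of_index i)"
      using odd_has_val_sign[of x] by blast
    then show "x \<in> (\<Union>i\<in>component_index t. M i)" using cover by blast
  qed
  show ?thesis
    unfolding minimal_decomposition_def
  proof (intro conjI)
    show "{0, 1, - 1} \<union> (\<Union>i\<in>component_index t. M i) \<union> (range ((*) 2) - {0}) = UNIV"
      unfolding units using even by blast
    show "{0, 1, - 1} \<inter> (\<Union>i\<in>component_index t. M i) = {}"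
      unfolding units using has_val_nonzero[of 0 0] by auto
    show "{0, 1, - 1 :: two_adic} \<inter> (range ((*) 2) - {0}) = {}"
      using even has_val_sign by blast
    show "(\<Union>i\<in>component_index t. M i) \<inter> (range ((*) 2) - {0}) = {}"
      unfolding units using even by blast
    show "{0, 1, - 1} = periodic_points (\<lambda>x :: two_adic. x ^ m)"
      using periodic_points_power[OF m] by simp
    show "countable (component_index t)" by simp
    show "disjoint_family_on M (component_index t)"
      unfolding disjoint_family_on_def
    proof (intro ballI impI)
      fix p q assume pq: "p \<in> component_index t" "q \<in> component_index t" "p \<noteq> q"
      obtain l a i l' a' i' where p: "p = (l, a, i)" and q: "q = (l', a', i')"
        by (metis prod.exhaust)
      have "False" if y: "y \<in> M p" "y \<in> M q" for y
      proof -
        have "i = i' \<and> l = l'"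
          using pq y unfolding p q component_index_def
          by (intro sign_of_index_unique[of _ y] val) auto
        moreover from this have "a = a'" using sep pq y unfolding p q by blast
        ultimately show False using pq(3) p q by simp
      qed
      then show "M p \<inter> M q = {}" by blast
    qed
    show "\<forall>i\<in>component_index t. minimal_component (\<lambda>x. x ^ m) (M i)"
      using minimal by auto
    have "forward_orbit (\<lambda>x :: two_adic. x ^ m) 0 = {0}"
      using m by (auto simp: forward_orbit_def funpow_power power_0_left)
    then show "\<forall>x\<in>range ((*) 2) - {0 :: two_adic}.
       (\<exists>y\<in>{0, 1, - 1}. x \<in> attracting_basin (\<lambda>x. x ^ m) (forward_orbit (\<lambda>x. x ^ m) y)) \<or>
       (\<exists>i\<in>component_index t. x \<in> attracting_basin (\<lambda>x. x ^ m) (M i))"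
      using attracting_basin_zero[OF m(1)] by auto
  qed
qed


section \<open>Exponents congruent to 1 modulo 4\<close>

text \<open>The index \<open>a\<close> consists of the first \<open>n\<close> binary digits of
  \<open>u\<close>. The lemma is applied with \<open>n = t - 1\<close> and \<open>j\<close> equal to
  \<open>l + 3\<close> or \<open>l + 4\<close>.\<close>

lemma coset_cover:
  assumes "y = b + 2 ^ j * u"
  shows "\<exists>a < 2 ^ n. 2 ^ (n + j) dvd y - (b + 2 ^ j * of_nat a :: two_adic)"
proof -
  obtain a z where a: "u = of_nat a + 2 ^ n * z" "a < 2 ^ n" by (rule two_adic_approx)
  then have "y - (b + 2 ^ j * of_nat a) = 2 ^ (n + j) * z"
    using assms by (simp add: power_add algebra_simps)
  then show ?thesis using a(2) by auto
qed

lemma coset_index_unique: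
  assumes "2 ^ (n + j) dvd y - (b + 2 ^ j * of_nat a :: two_adic)"
    "2 ^ (n + j) dvd y - (b + 2 ^ j * of_nat a')" "a < 2 ^ n" "a' < 2 ^ n"
  shows "a = a'"
proof -
  have "2 ^ (j + n) dvd 2 ^ j * (of_int (int a - int a') :: two_adic)"
    using dvd_diff[OF assms(2,1)] by (simp add: algebra_simps)
  then have "2 ^ n dvd int a - int a'"
    unfolding pow2_dvd_cancel pow2_dvd_of_int .
  then have "int a mod int (2 ^ n) = int a' mod int (2 ^ n)"
    by (simp add: mod_eq_dvd_iff)
  then show ?thesis using assms(3,4) by (simp flip: of_nat_mod)
qed

lemma component_index_iff: "(l, a, i) \<in> component_index t \<longleftrightarrow> a < 2 ^ (t - 1) \<and> i \<in> {1, 2}"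
proof -
  have "a \<le> 2 ^ (t - 1) - 1 \<longleftrightarrow> a < 2 ^ (t - 1)"
    by (metis One_nat_def Suc_pred less_Suc_eq_le pos2 zero_less_power)
  then show ?thesis by (simp add: component_index_def)
qed

lemma minimal_decomposition_1_mod_4:
  assumes m: "m = 1 + 2 ^ t * w" and w: "odd w" and t: "t \<ge> 2"
  shows "minimal_decomposition (\<lambda>x. x ^ m) {0, 1, - 1} (component_index t) (component_1_mod_4 t)
          (range ((*) 2) - {0})"
proof -
  \<comment> \<open>Splitting \<open>t + l + 2\<close> as \<open>(t - 1) + (l + 3)\<close> separates
    the digits of \<open>a\<close> from the fixed lower ones.\<close>
  have mem: "y \<in> component_1_mod_4 t (l, a, i) \<longleftrightarrow>
      2 ^ (t - 1 + (l + 3)) dvd y - (sign_of_index i + 2 ^ (l + 2) + 2 ^ (l + 3) * of_nat a)" for l a i y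
  proof -
    have "t - 1 + (l + 3) = t + l + 2" using t by simp
    then show ?thesis by (simp only: component_1_mod_4_def mem_two_adic_coset prod.case)
  qed
  have val: "has_val (l + 2) (y - sign_of_index i)" if "y \<in> component_1_mod_4 t (l, a, i)" for l a i y
  proof -
    have "has_val (l + 2) (2 ^ (l + 2) + 2 ^ (l + 3) * of_nat a)"
      unfolding has_val_def by (intro exI[of _ "of_nat a"]) (simp add: algebra_simps numeral_eq_Suc)
    moreover have "2 ^ Suc (l + 2) dvd y - (sign_of_index i + 2 ^ (l + 2) + 2 ^ (l + 3) * of_nat a)"
      using that unfolding mem by (rule pow2_dvd_le) simp
    ultimately show ?thesis using has_val_add by fastforce
  qed
  show ?thesis
  proof (rule minimal_decomposition_powerI[OF _ _ val])
    have "2 ^ t * w > 0" using odd_pos[OF w] by simp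
    then show "m \<ge> 2" using m by linarith
    show "odd m" using m t by simp
  next
    fix l a a' i y
    assume "(l, a, i) \<in> component_index t" "(l, a', i) \<in> component_index t"
      "y \<in> component_1_mod_4 t (l, a, i)" "y \<in> component_1_mod_4 t (l, a', i)"
    then show "a = a'" unfolding mem component_index_iff using coset_index_unique by blast
  next
    fix l i y assume i: "i \<in> {1, 2 :: nat}" and "has_val (l + 2) (y - sign_of_index i)"
    then obtain u where "y - sign_of_index i = 2 ^ (l + 2) * (1 + 2 * u)"
      unfolding has_val_def by blast
    then have "y = sign_of_index i + 2 ^ (l + 2) + 2 ^ (l + 3) * u"
      by (simp add: algebra_simps numeral_eq_Suc)
    from coset_cover[OF this]
    show "\<exists>a. (l, a, i) \<in> component_index t \<and> y \<in> component_1_mod_4 t (l, a, i)"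
      unfolding mem component_index_iff using i by blast
  next
    fix l a i
    define c :: two_adic where "c = sign_of_index i + 2 ^ (l + 2) + 2 ^ (l + 3) * of_nat a"
    have A: "component_1_mod_4 t (l, a, i) = two_adic_coset c (l + 2 + t)"
      by (simp add: component_1_mod_4_def c_def ac_simps)
    show "minimal_component (\<lambda>x. x ^ m) (component_1_mod_4 t (l, a, i))"
    proof (rule minimal_component_cosetsI)
      show "component_1_mod_4 t (l, a, i) = (\<Union>c\<in>{c}. two_adic_coset c (l + 2 + t))"
        by (simp add: A)
    next
      fix x assume x: "x \<in> component_1_mod_4 t (l, a, i)"
      \<comment> \<open>Here \<open>2 ^ t * w = m - 1\<close>; multiplying by \<open>x\<close>
        yields \<open>x ^ m - x\<close>.\<close>
      have "has_val (l + 2 + t) (x ^ (2 ^ t * w) - 1)"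
        using t by (intro has_val_power_minus_one[OF val[OF x] _ sign_of_index_in _ w]) auto
      from dvd_mult[OF has_val_dvd[OF this order_refl], of x]
      have "2 ^ (l + 2 + t) dvd x ^ m - x"
        by (simp add: m algebra_simps)
      moreover have "2 ^ (l + 2 + t) dvd x - c" using x by (simp add: A mem_two_adic_coset)
      ultimately have "2 ^ (l + 2 + t) dvd (x ^ m - x) + (x - c)" by (rule dvd_add)
      then show "x ^ m \<in> component_1_mod_4 t (l, a, i)" by (simp add: A mem_two_adic_coset)
    next
      fix x y N assume x: "x \<in> component_1_mod_4 t (l, a, i)" and y: "y \<in> component_1_mod_4 t (l, a, i)"
      have "2 ^ (l + 2 + t) dvd (x - c) - (y - c)"
        using x y unfolding A mem_two_adic_coset by (rule dvd_diff)
      then show "\<exists>n. 2 ^ N dvd x ^ m ^ n - y"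
        using t by (intro power_orbit_dense[OF val[OF x] _ sign_of_index_in m w]) auto
    qed auto
  qed
qed

section \<open>Exponents congruent to -1 modulo 4\<close>

lemma residue_eq_iff: "residue x n = residue y n \<longleftrightarrow> 2 ^ n dvd x - y"
  unfolding pow2_dvd_iff_residue minus_two_adic.rep_eq
  by (metis mod_eq_dvd_iff mod_eq_0_iff_dvd residue_mod)

text \<open>In the difference of squares, the factor \<open>x ^ 2 ^ n + 1\<close> is even and
  contributes one more power of 2.\<close>

lemma odd_power_pow2: "has_val 0 x \<Longrightarrow> 2 ^ n dvd x ^ 2 ^ n - 1"
proof (induction n)
  case (Suc n)
  have "2 dvd x ^ 2 ^ n + 1"
    using pow2_Suc_dvd_add[OF odd_power[OF Suc.prems, of "2 ^ n"], of 1]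
    by (simp add: has_val_def[of _ 1]) (metis mult_zero_right add.right_neutral)
  with Suc have "2 ^ n * 2 dvd (x ^ 2 ^ n - 1) * (x ^ 2 ^ n + 1)"
    by (intro mult_dvd_mono) auto
  also have "(x ^ 2 ^ n - 1) * (x ^ 2 ^ n + 1) = x ^ 2 ^ Suc n - 1"
    by (simp add: algebra_simps power_mult power2_eq_square)
  finally show ?case by (simp add: mult.commute)
qed simp

lemma two_adic_inv:
  assumes "has_val 0 x"
  shows "x * two_adic_inv x = 1"
proof -
  \<comment> \<open>\<open>x ^ 2 ^ n \<equiv> 1 (mod 2 ^ n)\<close>, so \<open>x ^ (2 ^ n - 1)\<close> inverts \<open>x\<close> modulo \<open>2 ^ n\<close>.\<close>
  define y where "y = (\<lambda>n. residue (x ^ (2 ^ n - 1)) n)"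
  have y: "y (Suc n) mod 2 ^ n = y n" for n
  proof -
    have "2 ^ n - 1 + 2 ^ n = (2 ^ Suc n - 1 :: nat)" by simp
    then have "x ^ (2 ^ Suc n - 1) - x ^ (2 ^ n - 1) = x ^ (2 ^ n - 1) * (x ^ 2 ^ n - 1)"
      by (simp only: right_diff_distrib power_add[symmetric] mult_1_right)
    then have "residue (x ^ (2 ^ Suc n - 1)) n = y n"
      unfolding y_def residue_eq_iff using odd_power_pow2[OF assms] by simp
    then show ?thesis by (simp add: y_def residue_Suc_mod)
  qed
  then have res: "residue (Abs_two_adic y) = y"
    by (simp add: Abs_two_adic_inverse)
  have "residue (x * Abs_two_adic y) n = residue 1 n" for n
  proof -
    have "residue (x * Abs_two_adic y) n = residue (x * x ^ (2 ^ n - 1)) n"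
      by (simp only: times_two_adic.rep_eq res) (simp add: y_def)
    also have "x * x ^ (2 ^ n - 1) = x ^ 2 ^ n"
      by (simp flip: power_Suc)
    also have "residue (x ^ 2 ^ n) n = residue 1 n"
      unfolding residue_eq_iff by (rule odd_power_pow2[OF assms])
    finally show ?thesis .
  qed
  then have inv: "x * Abs_two_adic y = 1"
    by (metis residue_inject ext)
  have "z = Abs_two_adic y" if "x * z = 1" for z
    using inv that by (metis mult.assoc mult.commute mult_1_left)
  then have "\<exists>!z. x * z = 1" using inv by blast
  then show ?thesis unfolding two_adic_inv_def by (rule theI')
qed


lemma has_val_odd_mult: "has_val 0 u \<Longrightarrow> has_val k (u * x) \<longleftrightarrow> has_val k x"
  unfolding has_val_iff[of k] by (simp only: odd_dvd_cancel)

text \<open>Multiplying by the unit \<open>c\<close> removes the inverse; \<open>c * 2 ^ k\<close>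
  may be replaced by \<open>2 ^ k\<close> modulo \<open>2 ^ Suc k\<close> because \<open>c\<close>
  is odd.\<close>

lemma inv_coset_iff:
  assumes "has_val 0 c"
  shows "y \<in> two_adic_coset (two_adic_inv c + 2 ^ k) (Suc k) \<longleftrightarrow> 2 ^ Suc k dvd c * y - 1 - 2 ^ k"
proof -
  obtain v where v: "c = 1 + 2 * v" using assms unfolding has_val_def by auto
  have "y \<in> two_adic_coset (two_adic_inv c + 2 ^ k) (Suc k) \<longleftrightarrow>
      2 ^ Suc k dvd c * (y - (two_adic_inv c + 2 ^ k))"
    unfolding mem_two_adic_coset odd_dvd_cancel[OF assms] ..
  also have "c * (y - (two_adic_inv c + 2 ^ k)) = (c * y - 1 - 2 ^ k) - 2 ^ Suc k * v"
  proof -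
    have "c * (y - (two_adic_inv c + 2 ^ k)) = c * y - c * two_adic_inv c - c * 2 ^ k"
      by (simp add: algebra_simps)
    also have "c * 2 ^ k = 2 ^ k + 2 ^ Suc k * v" by (simp add: v algebra_simps)
    finally show ?thesis using two_adic_inv[OF assms] by simp
  qed
  also have "2 ^ Suc k dvd \<dots> \<longleftrightarrow> 2 ^ Suc k dvd c * y - 1 - 2 ^ k"
    by (metis dvd_triv_left dvd_diff diff_add_cancel dvd_add)
  finally show ?thesis .
qed

lemma sign_power_odd: "odd m \<Longrightarrow> e \<in> {1, - 1} \<Longrightarrow> e ^ m = (e :: two_adic)"
  by auto

text \<open>With \<open>e\<close> the sign, points of the half \<open>C\<close> have
  \<open>y - e\<close> congruent to \<open>2 ^ (l + 2)\<close> modulo \<open>2 ^ (l + 4)\<close>,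
  those of \<open>D\<close> to \<open>3 * 2 ^ (l + 2)\<close>. Among points of valuation
  \<open>l + 2\<close> from \<open>e\<close>, \<open>D\<close> is the preimage of \<open>C\<close>,
  so index questions about \<open>D\<close> reduce to \<open>C\<close>.\<close>

lemma minimal_decomposition_3_mod_4:
  assumes m: "m + 1 = 2 ^ t * w" and w: "odd w" and t: "t \<ge> 2"
  shows "minimal_decomposition (\<lambda>x. x ^ m) {0, 1, - 1} (component_index t) (component_3_mod_4 t)
          (range ((*) 2) - {0})"
proof -
  define c :: "nat \<Rightarrow> nat \<Rightarrow> nat \<Rightarrow> two_adic"
    where "c = (\<lambda>l a i. sign_of_index i + 2 ^ (l + 2) + 2 ^ (l + 4) * of_nat a)"
  define C where "C = (\<lambda>l a i. two_adic_coset (c l a i) (Suc (t + l + 2)))"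
  define D where "D = (\<lambda>l a i. two_adic_coset (two_adic_inv (c l a i) + 2 ^ (t + l + 2)) (Suc (t + l + 2)))"
  have comp: "component_3_mod_4 t (l, a, i) = C l a i \<union> D l a i" for l a i
    by (simp add: component_3_mod_4_def C_def D_def c_def Let_def numeral_eq_Suc)
  \<comment> \<open>\<open>q\<close> is \<open>(m - 1) / 2\<close>, odd because \<open>m\<close> is
    3 modulo 4. Hence \<open>m ^ 2 - 1 = 4 * q * (q + 1)\<close> has valuation exactly
    \<open>t + 1\<close>.\<close>
  obtain q where q: "m = 2 * q + 1" "odd q" "q + 1 = 2 ^ (t - 1) * w"
  proof -
    obtain s where s: "t = Suc (Suc s)" using t by (metis add_2_eq_Suc le_Suc_ex)
    define q where "q = 2 * (2 ^ s * w) - 1"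
    have "2 ^ s * w > 0" using odd_pos[OF w] by simp
    then have "q + 1 = 2 * (2 ^ s * w)" by (simp add: q_def)
    moreover from this have "odd q" by (metis even_add even_mult_iff odd_one even_numeral)
    ultimately show thesis using m s by (intro that[of q]) auto
  qed
  have sq: "m ^ 2 = 1 + 2 ^ (t + 1) * (q * w)"
  proof -
    have "m ^ 2 = 1 + 4 * (q * (q + 1))" using q(1) by (simp add: power2_eq_square algebra_simps)
    also have "4 * (q * (q + 1)) = 2 ^ (t + 1) * (q * w)"
      using t unfolding q(3) by (cases t) auto
    finally show ?thesis .
  qed
  have val_c: "has_val (l + 2) (c l a i - sign_of_index i)" for l a i
    unfolding has_val_def c_def
    by (intro exI[of _ "2 * of_nat a"]) (simp add: algebra_simps numeral_eq_Suc)
  have odd_c: "has_val 0 (c l a i)" for l a i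
    using has_val_sign_imp_odd[OF val_c sign_of_index_in] .
  have C_iff: "y \<in> C l a i \<longleftrightarrow> 2 ^ Suc (t + l + 2) dvd y - c l a i" for l a i y
    by (simp only: C_def mem_two_adic_coset)
  have D_iff: "y \<in> D l a i \<longleftrightarrow> 2 ^ Suc (t + l + 2) dvd c l a i * y - 1 - 2 ^ (t + l + 2)" for l a i y
    unfolding D_def by (rule inv_coset_iff[OF odd_c])
  have val_C: "has_val (l + 2) (y - sign_of_index i)" if "y \<in> C l a i" for l a i y
  proof -
    have "2 ^ Suc (l + 2) dvd y - c l a i"
      using that unfolding C_iff by (rule pow2_dvd_le) simp
    from has_val_add[OF val_c[of l a i] this] show ?thesis by simp
  qed
  have val_D: "has_val (l + 2) (y - sign_of_index i)" if "y \<in> D l a i" for l a i y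
  proof -
    define e where "e = sign_of_index i"
    have e: "e \<in> {1, - 1}" unfolding e_def by (rule sign_of_index_in)
    have "2 ^ (t + l + 2) dvd c l a i * y - 1 - 2 ^ (t + l + 2)"
      using that unfolding D_iff by (rule pow2_dvd_le) simp
    from dvd_add[OF this dvd_refl] have "2 ^ (t + l + 2) dvd c l a i * y - 1"
      by (simp only: diff_add_cancel)
    then have "2 ^ Suc (l + 2) dvd c l a i * y - 1"
      by (rule pow2_dvd_le) (use t in simp)
    \<comment> \<open>\<open>1 - e * c\<close> equals \<open>- e * (c - e)\<close>. Adding
      \<open>c * y - 1\<close>, which has a higher power of 2, gives \<open>c * (y - e)\<close>, and
      \<open>c\<close> is a unit.\<close>
    moreover have "has_val (l + 2) (1 - e * c l a i)"
      using val_c[of l a i] has_val_minus[of _ "c l a i - e"] e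
      unfolding e_def[symmetric] by (auto simp: algebra_simps)
    ultimately have "has_val (l + 2) ((1 - e * c l a i) + (c l a i * y - 1))"
      by (intro has_val_add)
    also have "(1 - e * c l a i) + (c l a i * y - 1) = c l a i * (y - e)"
      by (simp add: algebra_simps)
    finally show ?thesis unfolding has_val_odd_mult[OF odd_c] e_def .
  qed
  \<comment> \<open>The product is \<open>y ^ (m + 1)\<close> with \<open>m + 1 = 2 ^ t * w\<close>,
    so \<open>y ^ (m + 1) - 1\<close> has valuation exactly \<open>t + l + 2\<close>; subtracting
    that power of 2 cancels the leading digit.\<close>
  have product: "2 ^ Suc (t + l + 2) dvd y * y ^ m - 1 - 2 ^ (t + l + 2)"
    if "has_val (l + 2) (y - sign_of_index i)" for l i y
  proof -
    have "has_val (l + 2 + t) (y ^ (2 ^ t * w) - 1)"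
      using t by (intro has_val_power_minus_one[OF that _ sign_of_index_in _ w]) auto
    then have "has_val (t + l + 2) (y * y ^ m - 1)"
      unfolding m[symmetric] by (simp add: ac_simps)
    moreover have "has_val (t + l + 2) (- (2 ^ (t + l + 2)))"
      unfolding has_val_def by (intro exI[of _ "- 1"]) simp
    ultimately show ?thesis using pow2_Suc_dvd_add by fastforce
  qed
  have power_in_C_iff: "y ^ m \<in> C l a i \<longleftrightarrow> y \<in> D l a i"
    if y: "has_val (l + 2) (y - sign_of_index i)" for l a i y
  proof -
    have odd_y: "has_val 0 y" using has_val_sign_imp_odd[OF y sign_of_index_in] .
    have "y ^ m \<in> C l a i \<longleftrightarrow> 2 ^ Suc (t + l + 2) dvd y * (y ^ m - c l a i)"
      unfolding C_iff odd_dvd_cancel[OF odd_y] ..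
    also have "y * (y ^ m - c l a i) =
        (y * y ^ m - 1 - 2 ^ (t + l + 2)) - (c l a i * y - 1 - 2 ^ (t + l + 2))"
      by (simp add: algebra_simps)
    also have "2 ^ Suc (t + l + 2) dvd \<dots> \<longleftrightarrow> y \<in> D l a i"
      unfolding D_iff by (rule dvd_diff_right_iff[OF product[OF y]])
    finally show ?thesis .
  qed
  have power_in_D: "y ^ m \<in> D l a i" if y: "y \<in> C l a i" for l a i y
  proof -
    have "2 ^ Suc (t + l + 2) dvd (y * y ^ m - 1 - 2 ^ (t + l + 2)) - (y - c l a i) * y ^ m"
      using dvd_diff[OF product[OF val_C[OF y]] dvd_mult2[OF y[unfolded C_iff]]] .
    then show ?thesis unfolding D_iff by (simp add: algebra_simps)
  qed
  \<comment> \<open>Near \<open>e = \<plusminus>1\<close> the map acts like inversion: modulo \<open>2 ^ (l + 4)\<close> it negates \<open>y - e\<close>, which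
    separates the two halves of a component.\<close>
  have sum: "2 ^ (l + 4) dvd (y - sign_of_index i) + (y ^ m - sign_of_index i)"
    if y: "has_val (l + 2) (y - sign_of_index i)" for l i y
  proof -
    define e where "e = sign_of_index i"
    have e: "e \<in> {1, - 1}" unfolding e_def by (rule sign_of_index_in)
    have em: "e ^ m = e" using q(1) e by (intro sign_power_odd) auto
    have y2: "2 ^ (l + 2) dvd y - e" using y unfolding e_def has_val_iff by blast
    \<comment> \<open>This makes the second-order term \<open>(y - e) * (y ^ m - e)\<close> vanish
      modulo \<open>2 ^ (l + 4)\<close>, leaving the linear part of
      \<open>y * y ^ m - 1\<close>.\<close>
    have "2 ^ 2 dvd y ^ m - e"
      using dvd_trans[OF pow2_dvd_le[OF y2, of 2] diff_dvd_power_diff[of y e m]] em by simp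
    from mult_dvd_mono[OF y2 this] have "2 ^ (l + 4) dvd (y - e) * (y ^ m - e)"
      by (simp add: power_add mult.commute)
    moreover have "2 ^ (l + 4) dvd y * y ^ m - 1"
    proof -
      have "2 ^ (t + l + 2) dvd y * y ^ m - 1 - 2 ^ (t + l + 2)"
        using product[OF y] by (rule pow2_dvd_le) simp
      from dvd_add[OF this dvd_refl] have "2 ^ (t + l + 2) dvd y * y ^ m - 1"
        by (simp only: diff_add_cancel)
      then show ?thesis by (rule pow2_dvd_le) (use t in simp)
    qed
    ultimately have "2 ^ (l + 4) dvd (y * y ^ m - 1) - (y - e) * (y ^ m - e)"
      by (rule dvd_diff[rotated])
    also have "(y * y ^ m - 1) - (y - e) * (y ^ m - e) = e * ((y - e) + (y ^ m - e))"
      using e by (auto simp: algebra_simps)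
    finally show ?thesis using odd_dvd_cancel[OF has_val_sign[OF e]] by (simp add: e_def)
  qed
  have C_iff': "y \<in> C l a i \<longleftrightarrow>
      2 ^ (t - 1 + (l + 4)) dvd y - (sign_of_index i + 2 ^ (l + 2) + 2 ^ (l + 4) * of_nat a)" for l a i y
  proof -
    have "t - 1 + (l + 4) = Suc (t + l + 2)" using t by simp
    then show ?thesis by (simp only: C_iff c_def)
  qed
  have C_unique: "a = a'"
    if "a < 2 ^ (t - 1)" "a' < 2 ^ (t - 1)" "y \<in> C l a i" "y \<in> C l a' i" for l a a' i y
    using that unfolding C_iff' using coset_index_unique by blast
  have C_mod: "2 ^ (l + 4) dvd y - sign_of_index i - 2 ^ (l + 2)" if "y \<in> C l a i" for l a i y
  proof -
    have "2 ^ (l + 4) dvd y - c l a i"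
      using that unfolding C_iff by (rule pow2_dvd_le) (use t in simp)
    from dvd_add[OF this, of "2 ^ (l + 4) * of_nat a"] show ?thesis
      by (simp add: c_def algebra_simps)
  qed
  \<comment> \<open>Otherwise \<open>y\<close> and \<open>y ^ m\<close> both lie in
    \<open>C\<close>-halves, and their differences from the sign add up to
    \<open>2 ^ (l + 3)\<close> instead of 0 modulo \<open>2 ^ (l + 4)\<close>.\<close>
  have C_D_disjoint: "False" if "y \<in> C l a i" "y \<in> D l a' i" for l a a' i y
  proof -
    have "y ^ m \<in> C l a' i" using power_in_C_iff that(2) val_D by blast
    from dvd_add[OF C_mod[OF that(1)] C_mod[OF this]] sum[OF val_C[OF that(1)]]
    have "2 ^ (l + 4) dvd ((y - sign_of_index i) + (y ^ m - sign_of_index i)) -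
      ((y - sign_of_index i - 2 ^ (l + 2)) + (y ^ m - sign_of_index i - 2 ^ (l + 2)))"
      by (rule dvd_diff[rotated])
    also have "\<dots> = 2 ^ (l + 3)" by (simp add: algebra_simps numeral_eq_Suc)
    finally show False
      using pow2_dvd_cancel[of "l + 3" 1 1] not_two_dvd_odd[of 0] by (simp add: numeral_eq_Suc)
  qed
  have odd_m: "odd m" and m2: "m \<ge> 2" using q by (auto elim: oddE)
  show ?thesis
  proof (rule minimal_decomposition_powerI[OF m2 odd_m])
    show "has_val (l + 2) (y - sign_of_index i)" if "y \<in> component_3_mod_4 t (l, a, i)" for l a i y
      using that val_C val_D unfolding comp by blast
  next
    fix l a a' i y
    assume index: "(l, a, i) \<in> component_index t" "(l, a', i) \<in> component_index t"
    assume "y \<in> component_3_mod_4 t (l, a, i)" "y \<in> component_3_mod_4 t (l, a', i)"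
    then consider "y \<in> C l a i" "y \<in> C l a' i" | "y \<in> D l a i" "y \<in> D l a' i"
      unfolding comp using C_D_disjoint by blast
    then show "a = a'"
    proof cases
      case 1
      then show ?thesis using index C_unique unfolding component_index_iff by blast
    next
      case 2
      then have "y ^ m \<in> C l a i" "y ^ m \<in> C l a' i" using power_in_C_iff val_D by blast+
      then show ?thesis using index C_unique unfolding component_index_iff by blast
    qed
  next
    fix l i y assume i: "i \<in> {1, 2 :: nat}" and y: "has_val (l + 2) (y - sign_of_index i)"
    have cover: "\<exists>a. (l, a, i) \<in> component_index t \<and> z \<in> C l a i"
      if "z = sign_of_index i + 2 ^ (l + 2) + 2 ^ (l + 4) * v" for z v
      using coset_cover[OF that] i unfolding C_iff' component_index_iff by blast
    obtain u where u: "y - sign_of_index i = 2 ^ (l + 2) * (1 + 2 * u)"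
      using y unfolding has_val_def by blast
    \<comment> \<open>The parity of \<open>u\<close> selects the half: for even \<open>u\<close> the
      point lies in \<open>C\<close>; for odd \<open>u\<close> the difference is
      \<open>2 ^ (l + 2) * (3 + 4 * v)\<close>, and its negation modulo \<open>2 ^ (l + 4)\<close>
      puts \<open>y ^ m\<close> into \<open>C\<close>.\<close>
    from even_or_odd[of u] consider v where "u = 2 * v" | v where "u = 1 + 2 * v"
      by (auto elim: dvdE)
    then show "\<exists>a. (l, a, i) \<in> component_index t \<and> y \<in> component_3_mod_4 t (l, a, i)"
    proof cases
      case (1 v)
      then have "y = sign_of_index i + 2 ^ (l + 2) + 2 ^ (l + 4) * v"
        using u by (simp add: algebra_simps numeral_eq_Suc)
      from cover[OF this] show ?thesis unfolding comp by blast
    next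
      case (2 v)
      obtain z where "(y - sign_of_index i) + (y ^ m - sign_of_index i) = 2 ^ (l + 4) * z"
        using sum[OF y] by (auto elim: dvdE)
      then have "y ^ m = sign_of_index i + 2 ^ (l + 2) + 2 ^ (l + 4) * (z - 1 - v)"
        unfolding u 2 by (simp add: algebra_simps numeral_eq_Suc)
      from cover[OF this] show ?thesis unfolding comp using power_in_C_iff[OF y] by blast
    qed
  next
    fix l a i
    let ?A = "component_3_mod_4 t (l, a, i)"
    have CD: "y ^ m \<in> C l a i" if "y \<in> D l a i" for y
      using power_in_C_iff[OF val_D[OF that]] that by simp
    \<comment> \<open>The level of each half is \<open>l + 2 + (t + 1)\<close>, exactly the one at
      which orbits of \<open>m ^ 2\<close> are dense.\<close>
    have even_orbit: "\<exists>n. 2 ^ N dvd x ^ m ^ (2 * n) - y"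
      if "x \<in> C l a i \<and> y \<in> C l a i \<or> x \<in> D l a i \<and> y \<in> D l a i" for x y N
    proof -
      have x: "has_val (l + 2) (x - sign_of_index i)" using that val_C val_D by blast
      have xy: "2 ^ (l + 2 + (t + 1)) dvd x - y"
      proof -
        have "2 ^ Suc (t + l + 2) dvd x - y"
          using that unfolding C_def D_def mem_two_adic_coset
          by (elim disjE conjE) (drule (1) dvd_diff, simp)+
        then show ?thesis by (simp add: ac_simps)
      qed
      have "\<exists>n. 2 ^ N dvd x ^ (m ^ 2) ^ n - y"
        using w q(2) t by (intro power_orbit_dense[OF x _ sign_of_index_in sq _ _ xy]) auto
      then show ?thesis by (simp add: power_mult)
    qed
    \<comment> \<open>For points in different halves, one application of the map first brings
      \<open>x\<close> into the half of \<open>y\<close>.\<close>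
    have odd_orbit: "\<exists>n. 2 ^ N dvd x ^ m ^ n - y"
      if xy: "x ^ m \<in> C l a i \<and> y \<in> C l a i \<or> x ^ m \<in> D l a i \<and> y \<in> D l a i" for x y N
    proof -
      obtain n where "2 ^ N dvd (x ^ m) ^ m ^ (2 * n) - y" using even_orbit[OF xy] by blast
      then show ?thesis by (intro exI[of _ "Suc (2 * n)"]) (simp add: power_mult)
    qed
    show "minimal_component (\<lambda>x. x ^ m) ?A"
    proof (rule minimal_component_cosetsI)
      show "?A = (\<Union>b\<in>{c l a i, two_adic_inv (c l a i) + 2 ^ (t + l + 2)}.
          two_adic_coset b (Suc (t + l + 2)))"
        by (simp add: comp C_def D_def)
      show "x ^ m \<in> ?A" if "x \<in> ?A" for x
        using that CD power_in_D unfolding comp by blast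
      show "\<exists>n. 2 ^ N dvd x ^ m ^ n - y" if "x \<in> ?A" "y \<in> ?A" for x y N
        using that even_orbit[of x y N] odd_orbit[of x y N] CD[of x] power_in_D[of x l a i]
        unfolding comp by blast
    qed auto
  qed
qed

theorem theorem3p6:
  fixes m :: nat and f :: "two_adic \<Rightarrow> two_adic"
  assumes "m \<ge> 2" and "[m = 1] (mod 2)" and "f = (\<lambda>x. x ^ m)"
  shows
    "([int m = 1] (mod 4) \<longrightarrow>
       (let t = multiplicity 2 (m - 1) in
        minimal_decomposition f {0, 1, - 1} (component_index t) (component_1_mod_4 t)
          (range ((*) 2) - {0}))) \<and>
     ([int m = - 1] (mod 4) \<longrightarrow>
       (let t = multiplicity 2 (m + 1) in
        minimal_decomposition f {0, 1, - 1} (component_index t) (component_3_mod_4 t)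
          (range ((*) 2) - {0}))) \<and>
     (\<forall>x\<in>{0, 1, - 1}. f x = x) \<and>
     attracting_basin f {0} - {0} = range ((*) 2) - {0}"
  unfolding Let_def assms(3)
proof (intro conjI impI)
  assume "[int m = 1] (mod 4)"
  \<comment> \<open>The congruence modulo 4 becomes the bound \<open>t \<ge> 2\<close> on the
    multiplicity.\<close>
  then have "4 dvd int (m - 1)" using assms(1) by (simp add: cong_iff_dvd_diff of_nat_diff)
  then have "2 ^ 2 dvd m - 1" using int_dvd_int_iff[of 4 "m - 1"] by simp
  moreover obtain w where "m - 1 = 2 ^ multiplicity 2 (m - 1) * w" "odd w"
    using multiplicity_decompose'[of "m - 1" 2] assms(1) by auto
  ultimately show "minimal_decomposition (\<lambda>x. x ^ m) {0, 1, - 1}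
      (component_index (multiplicity 2 (m - 1))) (component_1_mod_4 (multiplicity 2 (m - 1)))
      (range ((*) 2) - {0})"
    using assms(1) by (intro minimal_decomposition_1_mod_4[of _ _ w] multiplicity_geI) auto
next
  assume "[int m = - 1] (mod 4)"
  then have "4 dvd int (m + 1)" by (simp add: cong_iff_dvd_diff add.commute)
  then have "2 ^ 2 dvd m + 1" using int_dvd_int_iff[of 4 "m + 1"] by simp
  moreover obtain w where "m + 1 = 2 ^ multiplicity 2 (m + 1) * w" "odd w"
    using multiplicity_decompose'[of "m + 1" 2] by auto
  ultimately show "minimal_decomposition (\<lambda>x. x ^ m) {0, 1, - 1}
      (component_index (multiplicity 2 (m + 1))) (component_3_mod_4 (multiplicity 2 (m + 1)))
      (range ((*) 2) - {0})"
    by (intro minimal_decomposition_3_mod_4[of _ _ w] multiplicity_geI) auto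
next
  have "odd m" using assms(2) by (simp add: cong_def odd_iff_mod_2_eq_one)
  then show "\<forall>x\<in>{0, 1, - 1}. x ^ m = (x :: two_adic)"
    using assms(1) by (auto simp: power_0_left)
next
  show "attracting_basin (\<lambda>x :: two_adic. x ^ m) {0} - {0} = range ((*) 2) - {0}"
    using attracting_basin_zero[OF assms(1)] by simp
qed

end
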